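(* For any cubic polynomial $p:\mathbb{R}^n\to\mathbb{R}$, the closure $\overline{LM_p}$ of the set $LM_p$ of local minima of $p$ is a spectrahedron.
   Context: A cubic polynomial is a real polynomial all of whose monomials have degree at most 3. A point $\bar x$ is a local minimum of $p$ if there is $\epsilon>0$ such that $p(\bar x)\le p(y)$ for all $y$ with $\|y-\bar x\|\le\epsilon$. A spectrahedron in $\mathbb{R}^n$ is a set of the form $\{x\in\mathbb{R}^n \mid A_0+\sum_{i=1}^n x_iA_i\succeq 0\}$, where $A_0,\ldots,A_n$ are real symmetric matrices of some size $m\times m$ and $\succeq 0$ means positive semidefinite. (The empty set is a spectrahedron.) *)

theory Defs
  imports "HOL-Analysis.Analysis" "Jordan_Normal_Form.Matrix"
begin

no_notation Matrix.vec_index (infixl \<open>$\<close> 100)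
no_notation Matrix.scalar_prod (infix \<open>\<bullet>\<close> 70)

text \<open>A monomial in the variables \<open>x $ i\<close> is given by its exponent function \<open>\<alpha>\<close>; its degree is
  \<open>\<Sum>i. \<alpha> i\<close>. The degree of a cubic polynomial is at most, not exactly, three.\<close>

definition cubic_polynomial :: "(real ^ 'n \<Rightarrow> real) \<Rightarrow> bool" where
  "cubic_polynomial p \<longleftrightarrow>
    (\<exists>(M :: ('n \<Rightarrow> nat) set) (c :: ('n \<Rightarrow> nat) \<Rightarrow> real).
      finite M \<and> (\<forall>\<alpha>\<in>M. (\<Sum>i\<in>UNIV. \<alpha> i) \<le> 3) \<and>
      (\<forall>x. p x = (\<Sum>\<alpha>\<in>M. c \<alpha> * (\<Prod>i\<in>UNIV. (x $ i) ^ \<alpha> i))))"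

definition local_minimum :: "('a :: real_normed_vector \<Rightarrow> real) \<Rightarrow> 'a \<Rightarrow> bool" where
  "local_minimum p x \<longleftrightarrow> (\<exists>\<epsilon>>0. \<forall>y. norm (y - x) \<le> \<epsilon> \<longrightarrow> p x \<le> p y)"

definition symmetric_matrix :: "nat \<Rightarrow> real mat \<Rightarrow> bool" where
  "symmetric_matrix m A \<longleftrightarrow> A \<in> carrier_mat m m \<and> transpose_mat A = A"

definition positive_semidefinite :: "nat \<Rightarrow> real mat \<Rightarrow> bool" where
  "positive_semidefinite m A \<longleftrightarrow>
    symmetric_matrix m A \<and> (\<forall>v\<in>carrier_vec m. 0 \<le> scalar_prod v (A *\<^sub>v v))"

text \<open>The matrix \<open>A\<^sub>0 + (\<Sum>i. x\<^sub>i A\<^sub>i)\<close>, written entrywise because \<^typ>\<open>real mat\<close>, having a zero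
  matrix in every dimension, is not in the class required by \<^const>\<open>sum\<close>.\<close>

definition matrix_pencil ::
  "nat \<Rightarrow> real mat \<Rightarrow> ('n :: finite \<Rightarrow> real mat) \<Rightarrow> real ^ 'n \<Rightarrow> real mat" where
  "matrix_pencil m A0 A x =
    mat m m (\<lambda>(j, k). A0 $$ (j, k) + (\<Sum>i\<in>UNIV. x $ i * A i $$ (j, k)))"

text \<open>The size \<open>m\<close> may be \<open>0\<close>; this only yields the whole space, which a zero matrix of size
  \<open>1\<close> also yields.\<close>

definition spectrahedron :: "(real ^ 'n) set \<Rightarrow> bool" where
  "spectrahedron S \<longleftrightarrow>
    (\<exists>m (A0 :: real mat) (A :: 'n \<Rightarrow> real mat).
      symmetric_matrix m A0 \<and> (\<forall>i. symmetric_matrix m (A i)) \<and>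
      S = {x. positive_semidefinite m (matrix_pencil m A0 A x)})"

end

theory Submission
  imports Defs
begin

text \<open>Let \<open>T\<close> be the symmetric trilinear part of \<open>p\<close>. A critical point with positive semidefinite Hessian is a
  local minimum iff \<open>T v v = 0\<close> for every \<open>v\<close> in the kernel of its Hessian. If \<open>a\<close> is a local minimum,
  then the closure of the set of local minima consists of the \<open>x\<close> with positive semidefinite Hessian for which
  \<open>x - a\<close> lies in the kernel of the Hessian at \<open>a\<close>: for such \<open>x\<close> the Hessian is affine along the segment
  from \<open>a\<close> to \<open>x\<close>, so before reaching \<open>x\<close> its kernel is contained in the one at \<open>a\<close>, and all points of
  the half-open segment are local minima.\<close>

section \<open>Spectrahedra from pencils of bilinear forms\<close>

lemma bilinear_expand_Basis:
  fixes B :: "'b::euclidean_space \<Rightarrow> 'b \<Rightarrow> real"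
  assumes "bilinear B"
  shows "B u v = (\<Sum>b\<in>Basis. \<Sum>c\<in>Basis. (u \<bullet> b) * (v \<bullet> c) * B b c)"
proof -
  have "B u v = B (\<Sum>b\<in>Basis. (u \<bullet> b) *\<^sub>R b) (\<Sum>c\<in>Basis. (v \<bullet> c) *\<^sub>R c)"
    by (simp add: euclidean_representation)
  also have "\<dots> = (\<Sum>(b, c)\<in>Basis \<times> Basis. B ((u \<bullet> b) *\<^sub>R b) ((v \<bullet> c) *\<^sub>R c))"
    by (rule bilinear_sum[OF assms])
  also have "\<dots> = (\<Sum>b\<in>Basis. \<Sum>c\<in>Basis. (u \<bullet> b) * (v \<bullet> c) * B b c)"
    by (simp add: sum.cartesian_product bilinear_lmul[OF assms] bilinear_rmul[OF assms] mult_ac)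
  finally show ?thesis .
qed

lemma linear_expand_axis:
  fixes f :: "real ^ 'n \<Rightarrow> real"
  assumes "linear f"
  shows "f x = (\<Sum>i\<in>UNIV. x $ i * f (axis i 1))"
proof -
  have "f x = f (\<Sum>i\<in>UNIV. (x $ i) *\<^sub>R axis i 1)"
    using basis_expansion[of x] by (simp add: scalar_mult_eq_scaleR)
  also have "\<dots> = (\<Sum>i\<in>UNIV. x $ i * f (axis i 1))"
    by (simp add: linear_sum[OF assms] linear_cmul[OF assms])
  finally show ?thesis .
qed

text \<open>Allows a pencil to be given without coordinates on any Euclidean space, so that a
  bordered matrix can later be a form on a product space. The matrices are the Gram matrices of the
  forms in an enumerated basis.\<close>

lemma spectrahedron_bilinear_pencil:
  fixes F0 :: "'b::euclidean_space \<Rightarrow> 'b \<Rightarrow> real"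
    and F1 :: "real ^ 'n \<Rightarrow> 'b \<Rightarrow> 'b \<Rightarrow> real"
  assumes bil0: "bilinear F0" and sym0: "\<And>u v. F0 u v = F0 v u"
    and bil1: "\<And>x. bilinear (F1 x)" and sym1: "\<And>x u v. F1 x u v = F1 x v u"
    and lin1: "\<And>u v. linear (\<lambda>x. F1 x u v)"
  shows "spectrahedron {x. \<forall>u. 0 \<le> F0 u u + F1 x u u}"
proof -
  define m where "m = DIM('b)"
  obtain h where h: "bij_betw h {0..<m} (Basis :: 'b set)"
    using ex_bij_betw_nat_finite[of "Basis :: 'b set"] unfolding m_def by auto
  define A0 where "A0 = mat m m (\<lambda>(j, k). F0 (h j) (h k))"
  define A where "A i = mat m m (\<lambda>(j, k). F1 (axis i 1) (h j) (h k))" for i :: 'n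
  have symA: "symmetric_matrix m A0" "symmetric_matrix m (A i)" for i
    by (auto simp: symmetric_matrix_def A0_def A_def intro!: eq_matI sym0 sym1)
  have pencil: "matrix_pencil m A0 A x = mat m m (\<lambda>(j, k). F0 (h j) (h k) + F1 x (h j) (h k))" for x
    unfolding matrix_pencil_def
    by (rule eq_matI) (simp_all add: A0_def A_def linear_expand_axis[OF lin1, where x = x])
  have symP: "symmetric_matrix m (matrix_pencil m A0 A x)" for x
    unfolding pencil by (auto simp: symmetric_matrix_def intro!: eq_matI sym0 sym1 arg_cong2[where f = "(+)"])
  have quad: "scalar_prod v (matrix_pencil m A0 A x *\<^sub>v v) = F0 u u + F1 x u u"
    if "v \<in> carrier_vec m" "\<And>j. j < m \<Longrightarrow> u \<bullet> h j = vec_index v j" for x u v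
  proof -
    have "F0 u u + F1 x u u = (\<Sum>b\<in>Basis. \<Sum>c\<in>Basis. (u \<bullet> b) * (u \<bullet> c) * (F0 b c + F1 x b c))"
      by (subst bilinear_expand_Basis[OF bil0], subst bilinear_expand_Basis[OF bil1])
        (simp add: sum.distrib[symmetric] distrib_left)
    also have "\<dots> = (\<Sum>j\<in>{0..<m}. \<Sum>k\<in>{0..<m}. (u \<bullet> h j) * (u \<bullet> h k) * (F0 (h j) (h k) + F1 x (h j) (h k)))"
      by (simp only: sum.reindex_bij_betw[OF h, symmetric])
    also have "\<dots> = scalar_prod v (matrix_pencil m A0 A x *\<^sub>v v)"
      unfolding pencil using that
      by (auto simp: scalar_prod_def sum_distrib_left intro!: sum.cong)
    finally show ?thesis by simp
  qed
  have "positive_semidefinite m (matrix_pencil m A0 A x) \<longleftrightarrow> (\<forall>u. 0 \<le> F0 u u + F1 x u u)" for x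
  proof
    assume psd: "positive_semidefinite m (matrix_pencil m A0 A x)"
    show "\<forall>u. 0 \<le> F0 u u + F1 x u u"
    proof
      fix u
      have "scalar_prod (vec m (\<lambda>j. u \<bullet> h j)) (matrix_pencil m A0 A x *\<^sub>v vec m (\<lambda>j. u \<bullet> h j))
          = F0 u u + F1 x u u"
        by (rule quad) auto
      with psd show "0 \<le> F0 u u + F1 x u u"
        unfolding positive_semidefinite_def by (metis vec_carrier)
    qed
  next
    assume nonneg: "\<forall>u. 0 \<le> F0 u u + F1 x u u"
    have "0 \<le> scalar_prod v (matrix_pencil m A0 A x *\<^sub>v v)" if v: "v \<in> carrier_vec m" for v
    proof -
      \<comment> \<open>The vector whose coordinates in the basis enumerated by \<open>h\<close> are
        the entries of \<open>v\<close>; thus every test vector of the matrix comes from some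
        \<open>u\<close>.\<close>
      define u where "u = (\<Sum>b\<in>Basis. vec_index v (the_inv_into {0..<m} h b) *\<^sub>R b)"
      have "u \<bullet> h j = vec_index v j" if "j < m" for j
      proof -
        have "h j \<in> Basis" using h that by (auto simp: bij_betw_def)
        then show ?thesis
          unfolding u_def using h that
          by (simp add: bij_betw_def the_inv_into_f_f)
      qed
      then show ?thesis using quad[OF v] nonneg by metis
    qed
    then show "positive_semidefinite m (matrix_pencil m A0 A x)"
      unfolding positive_semidefinite_def using symP by blast
  qed
  then show ?thesis
    unfolding spectrahedron_def using symA by blast
qed

lemma spectrahedron_empty: "spectrahedron ({} :: (real ^ 'n) set)"
proof -
  \<comment> \<open>The constant pencil given by the 1-by-1 matrix with entry -1 is never positive
    semidefinite.\<close>
  have "spectrahedron {x :: real ^ 'n. \<forall>u. 0 \<le> - ((u::real) * u) + 0}"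
    by (rule spectrahedron_bilinear_pencil[of "\<lambda>u v. - (u * v)" "\<lambda>x u v. 0"])
      (auto simp: bilinear_def algebra_simps intro!: linearI)
  moreover have "{x :: real ^ 'n. \<forall>u. 0 \<le> - ((u::real) * u) + 0} = {}"
    by (auto intro!: exI[of _ 1])
  ultimately show ?thesis by simp
qed

lemma affine_bounded_below_imp_constant:
  fixes a b :: real
  assumes "\<And>c. 0 \<le> c * b + a"
  shows "b = 0"
proof (rule ccontr)
  assume "b \<noteq> 0"
  \<comment> \<open>At this \<open>c\<close> the affine function takes the value -1.\<close>
  then show False using assms[of "(- a - 1) / b"] by simp
qed

section \<open>Positive semidefinite bilinear forms\<close>

text \<open>On the line \<open>c *\<^sub>R v + w\<close> the quadratic coefficient
  \<open>B v v\<close> vanishes, so the form is affine in \<open>c\<close>; nonnegativity for all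
  real \<open>c\<close> kills the slope \<open>2 * B v w\<close>.\<close>

lemma psd_form_zero_imp_kernel:
  fixes B :: "'a::real_vector \<Rightarrow> 'a \<Rightarrow> real"
  assumes bil: "bilinear B" and sym: "\<And>x y. B x y = B y x" and psd: "\<And>y. 0 \<le> B y y"
    and zero: "B v v = 0"
  shows "B v w = 0"
proof -
  have "0 \<le> c * (2 * B v w) + B w w" for c
    using psd[of "c *\<^sub>R v + w"] sym[of w v] zero
    by (simp add: bilinear_ladd[OF bil] bilinear_radd[OF bil] bilinear_lmul[OF bil] bilinear_rmul[OF bil])
  from affine_bounded_below_imp_constant[OF this] show ?thesis by simp
qed

text \<open>On the compact set of unit vectors orthogonal to the kernel the form is positive,
  because a null vector would lie in the kernel and be orthogonal to itself. Its minimum there is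
  \<mu>, and homogeneity does the rest.\<close>

lemma psd_form_coercive:
  fixes B :: "'a::euclidean_space \<Rightarrow> 'a \<Rightarrow> real"
  assumes bil: "bilinear B" and sym: "\<And>x y. B x y = B y x" and psd: "\<And>y. 0 \<le> B y y"
  obtains \<mu> where "\<mu> > 0"
    and "\<And>w. (\<And>v. (\<And>z. B v z = 0) \<Longrightarrow> v \<bullet> w = 0) \<Longrightarrow> \<mu> * (norm w)\<^sup>2 \<le> B w w"
proof -
  define N where "N = {v. \<forall>z. B v z = 0}"
  define S where "S = sphere 0 1 \<inter> (\<Inter>v\<in>N. {w. v \<bullet> w = 0})"
  have "closed (\<Inter>v\<in>N. {w. v \<bullet> w = 0})"
    by (intro closed_INT ballI closed_Collect_eq continuous_intros)
  then have "compact S"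
    unfolding S_def by (intro compact_Int_closed compact_sphere)
  have contB: "continuous_on S (\<lambda>w. B w w)"
    using bounded_bilinear.continuous_on[OF bil[unfolded bilinear_conv_bounded_bilinear]
        continuous_on_id continuous_on_id] .
  have pos: "0 < B w w" if "w \<in> S" for w
  proof (rule ccontr)
    assume "\<not> 0 < B w w"
    then have "B w w = 0" using psd[of w] by simp
    then have "w \<in> N"
      unfolding N_def using psd_form_zero_imp_kernel[OF bil sym psd] by blast
    then show False using that unfolding S_def by auto
  qed
  obtain \<mu> where \<mu>: "\<mu> > 0" "\<And>w. w \<in> S \<Longrightarrow> \<mu> \<le> B w w"
  proof (cases "S = {}")
    case True
    \<comment> \<open>Here the kernel is the whole space, and any positive constant serves.\<close>
    then show ?thesis using that[of 1] by simp
  next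
    case False
    then obtain w0 where "w0 \<in> S" "\<And>w. w \<in> S \<Longrightarrow> B w0 w0 \<le> B w w"
      using continuous_attains_inf[OF \<open>compact S\<close> _ contB] by blast
    then show ?thesis using that pos by blast
  qed
  show thesis
  proof (rule that[OF \<mu>(1)])
    fix w assume w: "\<And>v. (\<And>z. B v z = 0) \<Longrightarrow> v \<bullet> w = 0"
    show "\<mu> * (norm w)\<^sup>2 \<le> B w w"
    proof (cases "w = 0")
      case True
      then show ?thesis using psd by simp
    next
      case False
      then have "w /\<^sub>R norm w \<in> S" unfolding S_def N_def using w by auto
      from \<mu>(2)[OF this] have "\<mu> \<le> B w w / (norm w)\<^sup>2"
        by (simp add: bilinear_lmul[OF bil] bilinear_rmul[OF bil] power2_eq_square divide_inverse mult_ac)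
      then show ?thesis using False by (simp add: field_simps)
    qed
  qed
qed

section \<open>Local minima of cubics\<close>

lemma nonneg_limit_at_right:
  fixes f :: "real \<Rightarrow> real"
  assumes "\<forall>\<^sub>F t in at_right 0. 0 \<le> t ^ k * f t" and "isCont f 0"
  shows "0 \<le> f 0"
proof (rule tendsto_lowerbound)
  show "(f \<longlongrightarrow> f 0) (at_right 0)"
    using assms(2) by (simp add: continuous_at_imp_continuous_at_within continuous_within[symmetric])
  show "\<forall>\<^sub>F t in at_right 0. 0 \<le> f t"
    using assms(1) eventually_at_right_less[of "0::real"]
    proof eventually_elim
    fix t assume "0 \<le> t ^ k * f t" "0 < t"
    then show "0 \<le> f t" by (meson mult_pos_neg not_le zero_less_power)
  qed
qed simp

text \<open>Common core of the tests of order 1 to 4 below: along a curve through a local minimum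
  the leading coefficient is nonnegative. Only t > 0 enters, so odd orders also give an
  inequality.\<close>

lemma local_minimum_path_nonneg:
  fixes p :: "'a::real_normed_vector \<Rightarrow> real" and f :: "real \<Rightarrow> real"
  assumes "local_minimum p x" and \<gamma>: "isCont \<gamma> 0" "\<gamma> 0 = 0"
    and eq: "\<And>t. p (x + \<gamma> t) = p x + t ^ k * f t" and "isCont f 0"
  shows "0 \<le> f 0"
proof (rule nonneg_limit_at_right)
  obtain \<epsilon> where \<epsilon>: "\<epsilon> > 0" "\<And>y. norm (y - x) \<le> \<epsilon> \<Longrightarrow> p x \<le> p y"
    using assms(1) unfolding local_minimum_def by blast
  have "(\<gamma> \<longlongrightarrow> 0) (at_right 0)"
    using \<gamma> by (metis continuous_at_imp_continuous_at_within continuous_within)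
  then have "\<forall>\<^sub>F t in at_right 0. norm (\<gamma> t) < \<epsilon>"
    using \<epsilon>(1) by (simp add: tendsto_iff)
  then show "\<forall>\<^sub>F t in at_right 0. 0 \<le> t ^ k * f t"
    by eventually_elim (use \<epsilon>(2) eq in \<open>smt (verit) add_diff_cancel_left'\<close>)
qed fact

text \<open>The polarised form of a cubic. Linearity is demanded in the first argument only; the
  symmetries carry it to the others.\<close>

locale cubic_expansion =
  fixes p :: "'a::euclidean_space \<Rightarrow> real" and k :: real and L :: "'a \<Rightarrow> real"
    and Q :: "'a \<Rightarrow> 'a \<Rightarrow> real" and T :: "'a \<Rightarrow> 'a \<Rightarrow> 'a \<Rightarrow> real"
  assumes linear_L: "linear L"
    and linear_Q: "\<And>y. linear (\<lambda>x. Q x y)" and Q_sym: "\<And>x y. Q x y = Q y x"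
    and linear_T: "\<And>y z. linear (\<lambda>x. T x y z)"
    and T_sym12: "\<And>x y z. T x y z = T y x z" and T_sym23: "\<And>x y z. T x y z = T x z y"
    and p_eq: "\<And>x. p x = k + L x + Q x x + T x x x"
begin

lemma T_sym13: "T x y z = T z y x"
  by (metis T_sym12 T_sym23)

lemma bilinear_Q: "bilinear Q"
  unfolding bilinear_def
proof (intro conjI allI)
  show "linear (Q x)" for x using linear_Q[of x] by (simp add: Q_sym[of _ x])
qed (rule linear_Q)

lemma bilinear_T: "bilinear (T x)"
  unfolding bilinear_def
proof (intro conjI allI)
  show "linear (\<lambda>y. T x y z)" for z using linear_T[of x z] by (subst T_sym12)
  show "linear (T x y)" for y using linear_T[of y x] by (simp add: T_sym13[of _ y x])
qed

lemmas L_simps = linear_add[OF linear_L] linear_cmul[OF linear_L]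
lemmas Q_simps = bilinear_ladd[OF bilinear_Q] bilinear_radd[OF bilinear_Q]
  bilinear_lmul[OF bilinear_Q] bilinear_rmul[OF bilinear_Q]
  bilinear_lsub[OF bilinear_Q] bilinear_rsub[OF bilinear_Q]
  bilinear_lneg[OF bilinear_Q] bilinear_rneg[OF bilinear_Q]
lemmas T_simps = bilinear_ladd[OF bilinear_T] bilinear_radd[OF bilinear_T]
  bilinear_lmul[OF bilinear_T] bilinear_rmul[OF bilinear_T]
  bilinear_lsub[OF bilinear_T] bilinear_rsub[OF bilinear_T]
  bilinear_lneg[OF bilinear_T] bilinear_rneg[OF bilinear_T]
  linear_add[OF linear_T] linear_cmul[OF linear_T] linear_diff[OF linear_T]
  linear_neg[OF linear_T]

section \<open>Derivatives and Taylor expansion of a cubic\<close>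

definition grad :: "'a \<Rightarrow> 'a \<Rightarrow> real" where
  "grad x y = L y + 2 * Q x y + 3 * T x x y"

text \<open>Affine in the base point \<open>x\<close>; both the segment argument and the linear
  matrix pencil rest on this.\<close>

definition hess :: "'a \<Rightarrow> 'a \<Rightarrow> 'a \<Rightarrow> real" where
  "hess x y z = 2 * Q y z + 6 * T x y z"

lemma hess_sym: "hess x y z = hess x z y"
  unfolding hess_def using Q_sym[of y] T_sym23[of x y] by simp

lemma bilinear_hess: "bilinear (hess x)"
  unfolding bilinear_def hess_def by (auto intro!: linearI simp: Q_simps T_simps algebra_simps)

lemmas hess_simps = bilinear_ladd[OF bilinear_hess] bilinear_radd[OF bilinear_hess]
  bilinear_lmul[OF bilinear_hess] bilinear_rmul[OF bilinear_hess]
  bilinear_lsub[OF bilinear_hess] bilinear_rsub[OF bilinear_hess]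
  bilinear_lneg[OF bilinear_hess] bilinear_rneg[OF bilinear_hess]

text \<open>Exact, since the degree is at most 3; the last term does not depend on
  \<open>x\<close>.\<close>

lemma taylor: "p (x + y) = p x + grad x y + hess x y y / 2 + T y y y"
proof -
  have "T x y x = T x x y" "T y x x = T x x y" "T y x y = T x y y" "T y y x = T x y y" "Q y x = Q x y"
    using T_sym12 T_sym23 Q_sym by metis+
  then show ?thesis
    unfolding p_eq grad_def hess_def by (simp add: L_simps Q_simps T_simps)
qed

lemma grad_shift: "grad (x + d) y = grad x y + hess x d y + 3 * T d d y"
  unfolding grad_def hess_def using T_sym12[of d x y] by (simp add: Q_simps T_simps)

lemma hess_shift: "hess (x + t *\<^sub>R d) y z = hess x y z + 6 * t * T d y z"
  unfolding hess_def by (simp add: T_simps algebra_simps)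

lemma grad_scale: "grad x (t *\<^sub>R y) = t * grad x y"
  unfolding grad_def by (simp add: L_simps Q_simps T_simps algebra_simps)

section \<open>Necessary conditions at a local minimum\<close>

lemma local_minimum_imp_grad_eq_0:
  assumes "local_minimum p x"
  shows "grad x y = 0"
proof -
  have ge: "0 \<le> grad x z" for z
  proof -
    have "0 \<le> (\<lambda>t. grad x z + t * (hess x z z / 2) + t\<^sup>2 * T z z z) 0"
      by (rule local_minimum_path_nonneg[OF assms, where \<gamma> = "\<lambda>t. t *\<^sub>R z" and k = 1])
        (auto simp: taylor grad_scale hess_simps T_simps algebra_simps power2_eq_square
          intro!: continuous_intros)
    then show ?thesis by simp
  qed
  \<comment> \<open>Opposite directions turn the inequality into an equality.\<close>
  show ?thesis using ge[of y] ge[of "- y"] grad_scale[of x "-1" y] by simp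
qed

lemma local_minimum_imp_hess_nonneg:
  assumes "local_minimum p x"
  shows "0 \<le> hess x y y"
proof -
  have "0 \<le> (\<lambda>t. hess x y y / 2 + t * T y y y) 0"
    by (rule local_minimum_path_nonneg[OF assms, where \<gamma> = "\<lambda>t. t *\<^sub>R y" and k = 2])
      (auto simp: taylor local_minimum_imp_grad_eq_0[OF assms] hess_simps T_simps algebra_simps
        power2_eq_square intro!: continuous_intros)
  then show ?thesis by simp
qed

text \<open>Moving along \<open>x + t v + c t\<^sup>2 w\<close> with \<open>v\<close> in the kernel of the Hessian, the leading term is
  \<open>t\<^sup>4 (c\<^sup>2 hess x w w / 2 + 3 c T v v w)\<close>; it must be nonnegative for every \<open>c\<close>.\<close>

lemma local_minimum_imp_third_order:
  assumes min: "local_minimum p x" and ker: "\<And>z. hess x v z = 0"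
  shows "T v v w = 0"
proof -
  \<comment> \<open>Order-three test in a null direction. Applied to \<open>v\<close> and
    \<open>- v\<close> it removes the t^3 term, so that the curved path below has leading order
    4.\<close>
  have Tvvv_ge: "0 \<le> T z z z" if z: "hess x z z = 0" for z
  proof -
    have "0 \<le> (\<lambda>t::real. T z z z) 0"
      by (rule local_minimum_path_nonneg[OF min, where \<gamma> = "\<lambda>t. t *\<^sub>R z" and k = 3])
        (auto simp: taylor local_minimum_imp_grad_eq_0[OF min] hess_simps T_simps z
          power3_eq_cube intro!: continuous_intros)
    then show ?thesis by simp
  qed
  have Tvvv: "T v v v = 0"
    using Tvvv_ge[of v] Tvvv_ge[of "- v"] by (simp add: hess_simps T_simps ker)
  have perm: "T v w v = T v v w" "T w v v = T v v w" "T w v w = T v w w" "T w w v = T v w w"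
    using T_sym12 T_sym23 by metis+
  have ker': "hess x w v = 0" using ker hess_sym by metis
  have step: "0 \<le> c * (3 * T v v w + c * (hess x w w / 2))" for c
  proof -
    have "0 \<le> (\<lambda>t. c * (3 * T v v w + c * (hess x w w / 2))
        + t * (3 * c\<^sup>2 * T v w w + t * c ^ 3 * T w w w)) 0"
    proof (rule local_minimum_path_nonneg[OF min, where \<gamma> = "\<lambda>t. t *\<^sub>R v + (c * t\<^sup>2) *\<^sub>R w" and k = 4])
      fix t
      show "p (x + (t *\<^sub>R v + (c * t\<^sup>2) *\<^sub>R w)) = p x + t ^ 4 *
         (c * (3 * T v v w + c * (hess x w w / 2)) + t * (3 * c\<^sup>2 * T v w w + t * c ^ 3 * T w w w))"
        unfolding taylor
        by (simp add: local_minimum_imp_grad_eq_0[OF min] hess_simps T_simps ker ker' Tvvv perm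
          algebra_simps power2_eq_square power3_eq_cube power4_eq_xxxx)
    qed (auto intro!: continuous_intros)
    then show ?thesis by simp
  qed
  \<comment> \<open>Here \<open>s\<close> is the sign of the path parameter: put
    \<open>s * c\<close> into \<open>step\<close>, divide by c > 0 and let c tend to 0. Both signs
    together give equality.\<close>
  have ge: "0 \<le> s * (3 * T v v w)" if "s\<^sup>2 = 1" for s
  proof -
    have "0 \<le> (\<lambda>c. s * (3 * T v v w) + c * (hess x w w / 2)) 0"
    proof (rule nonneg_limit_at_right[where k = 1])
      have "0 \<le> c ^ 1 * (s * (3 * T v v w) + c * (hess x w w / 2))" for c
        using step[of "s * c"] that by (simp add: algebra_simps power2_eq_square)
          (metis mult.assoc mult.left_commute mult_1)
      then show "\<forall>\<^sub>F c in at_right 0. 0 \<le> c ^ 1 * (s * (3 * T v v w) + c * (hess x w w / 2))"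
        by simp
    qed (auto intro!: continuous_intros)
    then show ?thesis by simp
  qed
  show ?thesis using ge[of 1] ge[of "-1"] by simp
qed

section \<open>Sufficient conditions for a local minimum\<close>

lemma T_bounded:
  obtains K where "K > 0" "\<And>x y z. \<bar>T x y z\<bar> \<le> K * norm x * norm y * norm z"
proof -
  \<comment> \<open>Each slice \<open>T b\<close> is a bounded bilinear form; expanding
    \<open>x\<close> in the basis reduces the trilinear bound to finitely many such slices.\<close>
  have "\<forall>b. \<exists>C>0. \<forall>y z. norm (T b y z) \<le> C * norm y * norm z"
    using bilinear_bounded_pos[OF bilinear_T] by meson
  then obtain C where C: "\<And>b. C b > 0" "\<And>b y z. norm (T b y z) \<le> C b * norm y * norm z"
    by metis
  have "\<bar>T x y z\<bar> \<le> (\<Sum>b\<in>Basis. C b) * norm x * norm y * norm z" for x y z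
  proof -
    have "T x y z = T (\<Sum>b\<in>Basis. (x \<bullet> b) *\<^sub>R b) y z"
      by (simp add: euclidean_representation)
    also have "\<dots> = (\<Sum>b\<in>Basis. (x \<bullet> b) * T b y z)"
      by (simp add: linear_sum[OF linear_T] T_simps)
    finally have "\<bar>T x y z\<bar> \<le> (\<Sum>b\<in>Basis. \<bar>(x \<bullet> b) * T b y z\<bar>)"
      by (simp add: sum_abs)
    also have "\<dots> \<le> (\<Sum>b\<in>Basis. norm x * (C b * norm y * norm z))"
      unfolding abs_mult using C(2) by (intro sum_mono mult_mono Basis_le_norm) auto
    finally show ?thesis by (simp add: sum_distrib_left sum_distrib_right mult_ac)
  qed
  moreover have "(\<Sum>b\<in>Basis. C b) > 0"
    using C(1) by (intro sum_pos) auto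
  ultimately show thesis using that by blast
qed

text \<open>Split a displacement as \<open>y = v + w\<close> with \<open>v\<close> in the kernel of
  the Hessian and \<open>w\<close> orthogonal to it. The Hessian sees only \<open>w\<close> and is
  at least \<mu> |w|^2, while \<open>third\<close> leaves only cubic terms of size O(|y| |w|^2),
  which are dominated for small \<open>y\<close>.\<close>

lemma local_minimumI:
  assumes grad: "\<And>y. grad x y = 0" and psd: "\<And>y. 0 \<le> hess x y y"
    and third: "\<And>v w. (\<And>z. hess x v z = 0) \<Longrightarrow> T v v w = 0"
  shows "local_minimum p x"
proof -
  obtain \<mu> where \<mu>: "\<mu> > 0"
    "\<And>w. (\<And>v. (\<And>z. hess x v z = 0) \<Longrightarrow> v \<bullet> w = 0) \<Longrightarrow> \<mu> * (norm w)\<^sup>2 \<le> hess x w w"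
    using psd_form_coercive[OF bilinear_hess hess_sym psd] by blast
  obtain K where K: "K > 0" "\<And>x y z. \<bar>T x y z\<bar> \<le> K * norm x * norm y * norm z"
    using T_bounded by blast
  define N where "N = {v. \<forall>z. hess x v z = 0}"
  have "subspace N"
    unfolding N_def subspace_def by (auto simp: hess_simps bilinear_lzero[OF bilinear_hess])
  \<comment> \<open>This radius makes the bound 4 K |y| |w|^2 on the cubic term at most half of
    \<mu> |w|^2, matching the factor 1/2 of the Hessian in \<open>taylor\<close>.\<close>
  have ge: "p x \<le> p (x + y)" if y: "norm y \<le> \<mu> / (8 * K)" for y
  proof -
    obtain v w where vw: "v \<in> span N" "\<And>z. z \<in> span N \<Longrightarrow> w \<bullet> z = 0" "y = v + w"
      using orthogonal_subspace_decomp_exists[of N y] unfolding real_inner_class.orthogonal_def by blast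
    have span: "span N = N" using \<open>subspace N\<close> by simp
    have "v \<in> N" using vw(1) unfolding span .
    then have ker: "hess x v z = 0" "hess x z v = 0" for z
      unfolding N_def using hess_sym[of x z v] by auto
    have "v \<bullet> w = 0" using vw(1,2) by (auto simp: inner_commute)
    then have norms: "(norm y)\<^sup>2 = (norm v)\<^sup>2 + (norm w)\<^sup>2"
      unfolding vw(3) by (simp add: power2_norm_eq_inner inner_add inner_commute)
    have nv: "norm v \<le> norm y" and nw: "norm w \<le> norm y"
      by (rule power2_le_imp_le; simp add: norms)+
    have hess: "\<mu> * (norm w)\<^sup>2 \<le> hess x y y"
    proof -
      have "\<mu> * (norm w)\<^sup>2 \<le> hess x w w"
        using vw(2) unfolding span by (intro \<mu>(2)) (auto simp: N_def inner_commute)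
      then show ?thesis unfolding vw(3) by (simp add: hess_simps ker)
    qed
    have perm: "T v w v = T v v w" "T w v v = T v v w" "T w v w = T v w w" "T w w v = T v w w"
      using T_sym12 T_sym23 by metis+
    have "T y y y = 3 * T v w w + T w w w"
      unfolding vw(3) using third[OF ker(1)] by (simp add: T_simps perm)
    moreover have "\<bar>T v w w\<bar> \<le> K * norm y * (norm w)\<^sup>2"
      using K(2)[of v w w] nv K(1)
      by (smt (verit) mult.assoc mult_left_mono mult_right_mono norm_ge_zero power2_eq_square)
    moreover have "\<bar>T w w w\<bar> \<le> K * norm y * (norm w)\<^sup>2"
      using K(2)[of w w w] nw K(1)
      by (smt (verit) mult.assoc mult_left_mono mult_right_mono norm_ge_zero power2_eq_square)
    ultimately have "\<bar>T y y y\<bar> \<le> 4 * (K * norm y * (norm w)\<^sup>2)" by linarith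
    also have "\<dots> = 4 * K * norm y * (norm w)\<^sup>2" by simp
    also have "\<dots> \<le> \<mu> / 2 * (norm w)\<^sup>2"
      using y K(1) by (intro mult_right_mono) (auto simp: field_simps)
    finally show ?thesis unfolding taylor using grad[of y] hess by linarith
  qed
  show ?thesis
    unfolding local_minimum_def
  proof (intro exI conjI allI impI)
    show "0 < \<mu> / (8 * K)" using \<mu>(1) K(1) by simp
    fix y assume "norm (y - x) \<le> \<mu> / (8 * K)"
    from ge[OF this] show "p x \<le> p y" by simp
  qed
qed

section \<open>Geometry of the set of local minima\<close>

text \<open>With d = b - a, the Hessians at \<open>a\<close> and \<open>b\<close> take the opposite
  values -3 \<open>T d d d\<close> and 3 \<open>T d d d\<close> on d. Both are nonnegative, hence
  zero, and a null vector of a semidefinite form lies in its kernel.\<close>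

lemma hess_kernel_of_critical_pair:
  assumes a: "\<And>y. grad a y = 0" "\<And>y. 0 \<le> hess a y y"
    and b: "\<And>y. grad b y = 0" "\<And>y. 0 \<le> hess b y y"
  shows "hess a (b - a) y = 0"
proof -
  let ?d = "b - a"
  have ha: "hess a ?d z = - 3 * T ?d ?d z" for z
    using grad_shift[of a ?d z] a(1)[of z] b(1)[of z] by simp
  have hb: "hess b ?d z = 3 * T ?d ?d z" for z
    using hess_shift[of a 1 ?d ?d z] ha[of z] by simp
  have "hess a ?d ?d = 0"
    using ha[of ?d] hb[of ?d] a(2)[of ?d] b(2)[of ?d] by linarith
  then show ?thesis
    using psd_form_zero_imp_kernel[OF bilinear_hess hess_sym a(2)] by blast
qed

lemma local_minimum_segment:
  assumes a: "local_minimum p a" and b: "\<And>y. hess a (b - a) y = 0" "\<And>y. 0 \<le> hess b y y"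
    and t: "0 \<le> t" "t < 1"
  shows "local_minimum p (a + t *\<^sub>R (b - a))"
proof -
  let ?d = "b - a"
  let ?x = "a + t *\<^sub>R ?d"
  have hx: "hess ?x y z = (1 - t) * hess a y z + t * hess b y z" for y z
    using hess_shift[of a t ?d y z] hess_shift[of a 1 ?d y z] by (simp add: algebra_simps)
  have psd_a: "0 \<le> hess a y y" for y by (rule local_minimum_imp_hess_nonneg[OF a])
  show ?thesis
  proof (rule local_minimumI)
    \<comment> \<open>The direction \<open>?d\<close> lies in the kernel of the Hessian at
      \<open>a\<close>, so the third-order condition there also kills the term in
      \<open>T ?d ?d\<close>.\<close>
    show "grad ?x y = 0" for y
      unfolding grad_shift bilinear_lmul[OF bilinear_hess] bilinear_lmul[OF bilinear_T] linear_cmul[OF linear_T]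
      using local_minimum_imp_third_order[OF a b(1)] local_minimum_imp_grad_eq_0[OF a]
      by (simp add: b(1))
    show "0 \<le> hess ?x y y" for y
      unfolding hx using psd_a b(2) t by simp
    fix v w assume ker: "\<And>z. hess ?x v z = 0"
    have "(1 - t) * hess a v v + t * hess b v v = 0" using ker[of v] unfolding hx .
    moreover have "0 \<le> t * hess b v v" "0 \<le> (1 - t) * hess a v v" using psd_a b(2) t by simp_all
    \<comment> \<open>Both summands are nonnegative, and t < 1 keeps the weight at \<open>a\<close>
      positive: the kernel at \<open>?x\<close> lies in the kernel at \<open>a\<close>.\<close>
    ultimately have "(1 - t) * hess a v v = 0" by linarith
    then have "hess a v v = 0" using t by simp
    then have "hess a v z = 0" for z
      using psd_form_zero_imp_kernel[OF bilinear_hess hess_sym psd_a] by blast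
    then show "T v v w = 0" by (rule local_minimum_imp_third_order[OF a])
  qed
qed

lemma closure_local_minima:
  assumes a: "local_minimum p a"
  shows "closure {x. local_minimum p x} =
    {x. (\<forall>y. hess a (x - a) y = 0) \<and> (\<forall>y. 0 \<le> hess x y y)}" (is "closure ?LM = ?R")
proof
  have cont1: "continuous_on UNIV (\<lambda>x. hess a (x - a) y)" for y
  proof -
    have "linear (\<lambda>x. hess a x y)" using bilinear_hess unfolding bilinear_def by simp
    from linear_continuous_on_compose[OF _ this, of UNIV "\<lambda>x. x - a"] show ?thesis
      by (simp add: continuous_on_diff)
  qed
  have cont2: "continuous_on UNIV (\<lambda>x. hess x y y)" for y
    unfolding hess_def using linear_continuous_on_compose[OF continuous_on_id linear_T]
    by (intro continuous_on_add continuous_on_mult continuous_on_const) auto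
  have "closed ?R"
    by (intro closed_Collect_conj closed_Collect_all closed_Collect_eq closed_Collect_le
        cont1 cont2 continuous_on_const)
  moreover have "?LM \<subseteq> ?R"
    using hess_kernel_of_critical_pair local_minimum_imp_hess_nonneg local_minimum_imp_grad_eq_0 a
    by blast
  ultimately show "closure ?LM \<subseteq> ?R" by (rule closure_minimal[rotated])
  show "?R \<subseteq> closure ?LM"
  proof
    fix b assume "b \<in> ?R"
    then have seg: "local_minimum p (a + t *\<^sub>R (b - a))" if "0 \<le> t" "t < 1" for t
      using local_minimum_segment[OF a] that by blast
    \<comment> \<open>The ratio n / (n + 1) stays below 1: the endpoint \<open>b\<close> itself may
      fail to be a local minimum.\<close>
    let ?s = "\<lambda>n. a + (real n / real (Suc n)) *\<^sub>R (b - a)"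
    have "?s \<longlonglongrightarrow> a + 1 *\<^sub>R (b - a)"
      by (intro tendsto_intros LIMSEQ_n_over_Suc_n)
    then have "?s \<longlonglongrightarrow> b" by simp
    moreover have "?s n \<in> ?LM" for n using seg by simp
    ultimately show "b \<in> closure ?LM"
      unfolding closure_sequential by (intro exI[of _ ?s] conjI allI)
  qed
qed

end

section \<open>Semidefinite representation of the closure\<close>

text \<open>A bordered symmetric matrix with top left entry \<open>0\<close> and border \<open>u\<close> around \<open>H\<close> is positive semidefinite iff
  \<open>u = 0\<close> and \<open>H\<close> is, which absorbs the linear equations of \<open>closure_local_minima\<close> into the pencil.\<close>

lemma spectrahedron_closure_local_minima:
  fixes p :: "real ^ 'n \<Rightarrow> real"
  assumes "cubic_expansion p k L Q T"
  shows "spectrahedron (closure {x. local_minimum p x})"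
proof (cases "{x. local_minimum p x} = {}")
  case True
  then show ?thesis by (simp only: closure_empty spectrahedron_empty)
next
  case False
  then obtain a where a: "local_minimum p a" by blast
  interpret cubic_expansion p k L Q T by fact
  \<comment> \<open>The first component of the product is the border coordinate. \<open>F0\<close>
    collects the part constant in \<open>x\<close> and \<open>F1\<close> the part linear in
    \<open>x\<close>; on (s, y) they add up to \<open>hess x y y\<close> plus 2 s times
    \<open>hess a (x - a) y\<close>.\<close>
  define F0 :: "real \<times> (real ^ 'n) \<Rightarrow> real \<times> (real ^ 'n) \<Rightarrow> real"
    where "F0 u v = hess 0 (snd u) (snd v) - fst u * hess a a (snd v) - fst v * hess a a (snd u)" for u v
  define F1 :: "real ^ 'n \<Rightarrow> real \<times> (real ^ 'n) \<Rightarrow> real \<times> (real ^ 'n) \<Rightarrow> real"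
    where "F1 x u v = 6 * T x (snd u) (snd v) + fst u * hess a x (snd v) + fst v * hess a x (snd u)" for x u v
  have "spectrahedron {x. \<forall>u. 0 \<le> F0 u u + F1 x u u}"
  proof (rule spectrahedron_bilinear_pencil[of F0 F1])
    show "F0 u v = F0 v u" for u v unfolding F0_def using hess_sym[of 0 "snd u"] by simp
    show "F1 x u v = F1 x v u" for x u v unfolding F1_def using T_sym23[of x "snd u"] by simp
  qed (auto simp: bilinear_def F0_def F1_def hess_simps T_simps algebra_simps intro!: linearI)
  moreover have "(\<forall>u. 0 \<le> F0 u u + F1 x u u) \<longleftrightarrow>
      (\<forall>y. hess a (x - a) y = 0) \<and> (\<forall>y. 0 \<le> hess x y y)" for x
  proof -
    have F: "F0 (s, y) (s, y) + F1 x (s, y) (s, y) = s * (2 * hess a (x - a) y) + hess x y y" for s y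
      using hess_shift[of 0 1 x y y] by (simp add: F0_def F1_def hess_simps algebra_simps)
    show ?thesis
    proof
      assume nonneg: "\<forall>u. 0 \<le> F0 u u + F1 x u u"
      then have ge: "0 \<le> s * (2 * hess a (x - a) y) + hess x y y" for s y
        using F by metis
      \<comment> \<open>For fixed \<open>y\<close> the bound is affine in the border coordinate,
        which ranges over all reals.\<close>
      have "hess a (x - a) y = 0" for y
        using affine_bounded_below_imp_constant[OF ge] by simp
      moreover have "0 \<le> hess x y y" for y using ge[of 0 y] by simp
      ultimately show "(\<forall>y. hess a (x - a) y = 0) \<and> (\<forall>y. 0 \<le> hess x y y)" by blast
    qed (auto simp: F)
  qed
  ultimately show ?thesis by (simp add: closure_local_minima[OF a])
qed

section \<open>Cubic polynomials as symmetric multilinear expressions\<close>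

lemma cubic_expansion_add:
  assumes "cubic_expansion p k L Q T" "cubic_expansion p' k' L' Q' T'"
  shows "cubic_expansion (\<lambda>x. p x + p' x) (k + k') (\<lambda>x. L x + L' x) (\<lambda>x y. Q x y + Q' x y)
    (\<lambda>x y z. T x y z + T' x y z)"
proof -
  interpret e: cubic_expansion p k L Q T by fact
  interpret e': cubic_expansion p' k' L' Q' T' by fact
  show ?thesis
  proof (rule cubic_expansion.intro)
    show "linear (\<lambda>x. L x + L' x)"
      by (rule linear_compose_add[OF e.linear_L e'.linear_L])
    show "linear (\<lambda>x. Q x y + Q' x y)" for y
      by (rule linear_compose_add[OF e.linear_Q e'.linear_Q])
    show "linear (\<lambda>x. T x y z + T' x y z)" for y z
      by (rule linear_compose_add[OF e.linear_T e'.linear_T])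
    show "Q x y + Q' x y = Q y x + Q' y x" for x y
      using e.Q_sym[of x y] e'.Q_sym[of x y] by simp
    show "T x y z + T' x y z = T y x z + T' y x z" for x y z
      using e.T_sym12[of x y z] e'.T_sym12[of x y z] by simp
    show "T x y z + T' x y z = T x z y + T' x z y" for x y z
      using e.T_sym23[of x y z] e'.T_sym23[of x y z] by simp
    show "p x + p' x = k + k' + (L x + L' x) + (Q x x + Q' x x) + (T x x x + T' x x x)" for x
      by (simp add: e.p_eq e'.p_eq)
  qed
qed

lemma cubic_expansion_scale:
  assumes "cubic_expansion p k L Q T"
  shows "cubic_expansion (\<lambda>x. c * p x) (c * k) (\<lambda>x. c * L x) (\<lambda>x y. c * Q x y) (\<lambda>x y z. c * T x y z)"
proof -
  interpret e: cubic_expansion p k L Q T by fact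
  show ?thesis
  proof (rule cubic_expansion.intro)
    show "linear (\<lambda>x. c * L x)"
      by (rule linearI) (simp_all add: e.L_simps distrib_left)
    show "linear (\<lambda>x. c * Q x y)" for y
      by (rule linearI) (simp_all add: e.Q_simps distrib_left)
    show "linear (\<lambda>x. c * T x y z)" for y z
      by (rule linearI) (simp_all add: e.T_simps distrib_left)
    show "c * Q x y = c * Q y x" for x y
      using e.Q_sym[of x y] by simp
    show "c * T x y z = c * T y x z" for x y z
      using e.T_sym12[of x y z] by simp
    show "c * T x y z = c * T x z y" for x y z
      using e.T_sym23[of x y z] by simp
    show "c * p x = c * k + c * L x + c * Q x x + c * T x x x" for x
      by (simp add: e.p_eq distrib_left)
  qed
qed

text \<open>Listing the variables with multiplicity turns the degree into a list length, so degree
  at most 3 leaves only four shapes to treat.\<close>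

lemma monomial_eq_prod_list:
  fixes \<alpha> :: "'n::finite \<Rightarrow> nat"
  shows "\<exists>is. length is = (\<Sum>i\<in>UNIV. \<alpha> i) \<and>
    (\<forall>x :: real ^ 'n. (\<Prod>i\<in>UNIV. (x $ i) ^ \<alpha> i) = prod_list (map (($) x) is))"
proof (induction "\<Sum>i\<in>UNIV. \<alpha> i" arbitrary: \<alpha>)
  case 0
  then show ?case by (intro exI[of _ "[]"]) simp
next
  case (Suc d)
  then obtain i where i: "\<alpha> i \<noteq> 0" by (metis nat.distinct(1) sum.neutral)
  \<comment> \<open>One factor \<open>x $ i\<close> is split off.\<close>
  define \<beta> where "\<beta> = \<alpha>(i := \<alpha> i - 1)"
  have sum: "(\<Sum>j\<in>UNIV. \<alpha> j) = Suc (\<Sum>j\<in>UNIV. \<beta> j)"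
    using i by (simp add: sum.remove[of UNIV i] \<beta>_def)
  have prod: "(\<Prod>j\<in>UNIV. (x $ j) ^ \<alpha> j) = x $ i * (\<Prod>j\<in>UNIV. (x $ j) ^ \<beta> j)" for x :: "real ^ 'n"
    using i by (cases "\<alpha> i") (simp_all add: prod.remove[of UNIV i] \<beta>_def mult.assoc)
  obtain "is" where "length is = (\<Sum>j\<in>UNIV. \<beta> j)"
    "\<And>x :: real ^ 'n. (\<Prod>j\<in>UNIV. (x $ j) ^ \<beta> j) = prod_list (map (($) x) is)"
    using Suc(1)[of \<beta>] Suc(2) sum by auto
  then show ?case by (intro exI[of _ "i # is"]) (simp add: sum prod)
qed

text \<open>Polarisation: a product of two or three coordinates is the diagonal value of its average
  over all permutations of the arguments, which is symmetric.\<close>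

lemma cubic_expansion_prod_list:
  fixes "is" :: "'n::finite list"
  assumes "length is \<le> 3"
  shows "\<exists>k L Q T. cubic_expansion (\<lambda>x :: real ^ 'n. prod_list (map (($) x) is)) k L Q T"
proof -
  consider "is = []" | i where "is = [i]" | i j where "is = [i, j]" | i j l where "is = [i, j, l]"
    using assms by (auto simp: numeral_3_eq_3 le_Suc_eq length_Suc_conv)
  then show ?thesis
  proof cases
    case 1
    show ?thesis unfolding 1
      by (rule exI[of _ 1], rule exI[of _ "\<lambda>x. 0"], rule exI[of _ "\<lambda>x y. 0"], rule exI[of _ "\<lambda>x y z. 0"])
        (unfold_locales, auto intro!: linearI)
  next
    case (2 i)
    show ?thesis unfolding 2
      by (rule exI[of _ 0], rule exI[of _ "\<lambda>x. x $ i"], rule exI[of _ "\<lambda>x y. 0"], rule exI[of _ "\<lambda>x y z. 0"])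
        (unfold_locales, auto intro!: linearI)
  next
    case (3 i j)
    show ?thesis unfolding 3
      by (rule exI[of _ 0], rule exI[of _ "\<lambda>x. 0"], rule exI[of _ "\<lambda>x y. (x $ i * y $ j + y $ i * x $ j) / 2"],
          rule exI[of _ "\<lambda>x y z. 0"])
        (unfold_locales, auto intro!: linearI simp: field_simps)
  next
    case (4 i j l)
    show ?thesis unfolding 4
      by (rule exI[of _ 0], rule exI[of _ "\<lambda>x. 0"], rule exI[of _ "\<lambda>x y. 0"],
          rule exI[of _ "\<lambda>x y z. (x $ i * y $ j * z $ l + x $ i * z $ j * y $ l + y $ i * x $ j * z $ l
            + y $ i * z $ j * x $ l + z $ i * x $ j * y $ l + z $ i * y $ j * x $ l) / 6"])
        (unfold_locales, auto intro!: linearI simp: field_simps)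
  qed
qed

lemma cubic_polynomial_imp_expansion:
  fixes p :: "real ^ 'n \<Rightarrow> real"
  assumes "cubic_polynomial p"
  shows "\<exists>k L Q T. cubic_expansion p k L Q T"
proof -
  obtain M c where M: "finite M" "\<And>\<alpha>. \<alpha> \<in> M \<Longrightarrow> (\<Sum>i\<in>UNIV. \<alpha> i) \<le> 3"
    and p: "p = (\<lambda>x. \<Sum>\<alpha>\<in>M. c \<alpha> * (\<Prod>i\<in>UNIV. (x $ i) ^ \<alpha> i))"
    using assms unfolding cubic_polynomial_def by (auto simp: fun_eq_iff)
  show ?thesis unfolding p using M
  proof (induction M rule: finite_induct)
    case empty
    have "cubic_expansion (\<lambda>x :: real ^ 'n. 0) 0 (\<lambda>x. 0) (\<lambda>x y. 0) (\<lambda>x y z. 0)"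
      by unfold_locales (auto intro!: linearI)
    then show ?case by (simp only: sum.empty) blast
  next
    case (insert \<alpha> M)
    obtain "is" where "is": "length is = (\<Sum>i\<in>UNIV. \<alpha> i)"
      "\<And>x :: real ^ 'n. (\<Prod>i\<in>UNIV. (x $ i) ^ \<alpha> i) = prod_list (map (($) x) is)"
      using monomial_eq_prod_list[of \<alpha>] by blast
    then obtain k L Q T where "cubic_expansion (\<lambda>x :: real ^ 'n. \<Prod>i\<in>UNIV. (x $ i) ^ \<alpha> i) k L Q T"
      using cubic_expansion_prod_list[of "is"] insert.prems[of \<alpha>] by auto
    note mono = cubic_expansion_scale[OF this, of "c \<alpha>"]
    obtain k' L' Q' T' where
      "cubic_expansion (\<lambda>x :: real ^ 'n. \<Sum>\<alpha>\<in>M. c \<alpha> * (\<Prod>i\<in>UNIV. (x $ i) ^ \<alpha> i)) k' L' Q' T'"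
      using insert.IH insert.prems by blast
    from cubic_expansion_add[OF mono this] show ?case
      unfolding sum.insert[OF insert.hyps] by blast
  qed
qed

theorem theorem4p5:
  fixes p :: "real ^ 'n \<Rightarrow> real"
  assumes "cubic_polynomial p"
  shows "spectrahedron (closure {x. local_minimum p x})"
  using cubic_polynomial_imp_expansion[OF assms] spectrahedron_closure_local_minima by blast

end
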